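(* Let $\mathcal V=(\mathcal V,\otimes,k)$ be a completely distributive quantale, and regard $\mathcal V_{\multimap}$ as a modular $\mathcal V$-valued topological space with $\mathcal V$-valued convergence $\nu_{\inf}(\mathfrak x,x)=\bigl(\sup_{S\in\mathfrak x}\inf S\bigr)\multimap x$. Let $A$ be a modular $\mathcal V$-valued pseudotopological space and $B$ a $\mathcal V$-category, let $d\colon A\to\mathcal V_{\multimap}$ be a continuous $\mathcal V$-functor and $J\colon A\nrightarrow B$ a $\mathcal V$-profunctor. The left Kan extension $l\colon B\to\mathcal V_{\multimap}$ of $d$ along $J$ satisfies the Beck–Chevalley condition whenever $J$ satisfies the following conditions: (a) $J$ is discrete, that is $\operatorname{im}J\subseteq\{\bot,k\}$; (b) $J$ is $U$-compact; (c) for each $y\in B$ the set $d(J_k^\circ y)$ is up-directed in $\mathcal V$; (d) for each $y\in B$, $$k\le\sup_{z\in d(J_k^\circ y)}\bigl(\sup d(J_k^\circ y)\multimap z\bigr).$$ Here $J_k^\circ y=\{x\in A\mid k\le J(x,y)\}$.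
   Context: A quantale $\mathcal V=(\mathcal V,\otimes,k)$ is a complete lattice with a (not necessarily commutative) monoid structure $\otimes$ with unit $k$ such that $\otimes$ preserves suprema in each variable; $\bot$ is its bottom element. It is completely distributive if the map $\sup$ from the set of downsets of $\mathcal V$ (ordered by inclusion) to $\mathcal V$ has a left adjoint. The operation $\multimap$ is defined by $y\le x\multimap z\iff x\otimes y\le z$. A $\mathcal V$-category is a set $A$ with $A(\cdot,\cdot)\colon A\times A\to\mathcal V$ such that $k\le A(x,x)$ and $A(x,y)\otimes A(y,z)\le A(x,z)$. A $\mathcal V$-functor $f\colon A\to C$ is a function with $A(x,y)\le C(fx,fy)$. A $\mathcal V$-relation $J\colon A\nrightarrow B$ between sets is a function $J\colon A\times B\to\mathcal V$; a $\mathcal V$-profunctor between $\mathcal V$-categories is a $\mathcal V$-relation with $A(x_1,x_2)\otimes J(x_2,y_1)\otimes B(y_1,y_2)\le J(x_1,y_2)$. $\mathcal V_{\multimap}$ is the $\mathcal V$-category with underlying set $\mathcal V$ and $\mathcal V_{\multimap}(x,y)=x\multimap y$. $UA$ denotes the set of ultrafilters on $A$; for $f\colon A\to C$, $(Uf)(\mathfrak x)=\{T\subseteq C\mid f^{-1}T\in\mathfrak x\}$; $\iota x$ is the principal ultrafilter on $x$. For a $\mathcal V$-relation $J\colon A\nrightarrow B$ put $(UJ)(\mathfrak x,\mathfrak y)=\inf_{S\in\mathfrak x,T\in\mathfrak y}\sup_{s\in S,t\in T}J(s,t)$. A modular $\mathcal V$-valued pseudotopological space is a $\mathcal V$-category $A$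 with a function $\alpha\colon UA\times A\to\mathcal V$ such that $k\le\alpha(\iota x,x)$ and $(UA(\cdot,\cdot))(\mathfrak x,\mathfrak y)\otimes\alpha(\mathfrak y,x)\otimes A(x,y)\le\alpha(\mathfrak x,y)$. (With $\nu_{\inf}$, $\mathcal V_\multimap$ is such a space, and it corresponds to a modular $\mathcal V$-valued topological space.) A map $f\colon(A,\alpha)\to(C,\gamma)$ is continuous if $\alpha(\mathfrak x,x)\le\gamma((Uf)(\mathfrak x),fx)$. $J\colon A\nrightarrow B$ (with $A=(A,\alpha)$) is $U$-compact if $\inf_{S\in\mathfrak x}\sup_{s\in S}J(s,y)\le\sup_{x\in A}\alpha(\mathfrak x,x)\otimes J(x,y)$ for all $\mathfrak x\in UA$, $y\in B$. A subset of $\mathcal V$ is up-directed if it is non-empty and each of its finite subsets has an upper bound in it. For a $\mathcal V$-functor $d\colon A\to M$ and a $\mathcal V$-profunctor $J\colon A\nrightarrow B$, a $\mathcal V$-functor $l\colon B\to M$ is the left Kan extension of $d$ along $J$ (in the thin equipment of $\mathcal V$-profunctors) if $J(x,y)\le M(dx,ly)$ for all $x,y$ and, for every $\mathcal V$-category $C$, $\mathcal V$-profunctor $H\colon B\nrightarrow C$ and $\mathcal V$-functor $g\colon C\to M$ with $J(x,y)\otimes H(y,z)\le M(dx,gz)$ for all $x,y,z$, one has $H(y,z)\le M(ly,gz)$ for all $y,z$. For $M=\mathcal V_{\multimap}$ it is given by $ly=\sup_{x\in A}dx\otimes J(x,y)$. It satisfies the Beck–Chevalley condition if $M(z,ly)=\sup_{x\in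 A}M(z,dx)\otimes J(x,y)$ for all $z\in M$, $y\in B$. *)

theory Defs
  imports Main
begin

section \<open>Quantales\<close>

text \<open>The tensor product is \<open>*\<close> and the unit \<open>k\<close> is \<open>1\<close>. Suprema of the empty set are included,
  so \<open>bot\<close> is absorbing.\<close>

class quantale = complete_lattice + monoid_mult +
  assumes Sup_mult: "Sup X * y = (SUP x\<in>X. x * y)"
    and mult_Sup: "x * Sup Y = (SUP y\<in>Y. x * y)"

definition (in order) downset :: "'a set \<Rightarrow> bool" where
  "downset D \<longleftrightarrow> (\<forall>x\<in>D. \<forall>y\<le>x. y \<in> D)"

text \<open>The map \<open>L\<close> is a left adjoint of \<open>Sup\<close> from downsets to the quantale; its monotonicity follows from
  the adjunction.\<close>

class completely_distributive_quantale = quantale +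
  assumes Sup_left_adjoint:
    "\<exists>L. (\<forall>v. downset (L v)) \<and> (\<forall>v D. downset D \<longrightarrow> (L v \<subseteq> D \<longleftrightarrow> v \<le> Sup D))"

definition lhom :: "'v::quantale \<Rightarrow> 'v \<Rightarrow> 'v"  (infixr \<open>-\<circ>\<close> 65) where
  "x -\<circ> z = Sup {y. x * y \<le> z}"

lemma mult_mono_quantale:
  fixes a b c d :: "'v::quantale"
  assumes "a \<le> b" "c \<le> d"
  shows "a * c \<le> b * d"
proof -
  have "a * c \<le> (SUP x\<in>{a, b}. x * c)"
    by (simp add: SUP_upper)
  also have "\<dots> = Sup {a, b} * c"
    by (rule Sup_mult [symmetric])
  also have "\<dots> = b * c"
    using assms(1) by (simp add: sup_absorb2)
  finally have 1: "a * c \<le> b * c" .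
  have "b * c \<le> (SUP y\<in>{c, d}. b * y)"
    by (simp add: SUP_upper)
  also have "\<dots> = b * Sup {c, d}"
    by (rule mult_Sup [symmetric])
  also have "\<dots> = b * d"
    using assms(2) by (simp add: sup_absorb2)
  finally show ?thesis
    using 1 by (rule order_trans [rotated])
qed

lemma lhom_galois: "y \<le> x -\<circ> z \<longleftrightarrow> x * y \<le> z"
proof
  assume "y \<le> x -\<circ> z"
  then have "x * y \<le> x * Sup {y. x * y \<le> z}"
    unfolding lhom_def by (intro mult_mono_quantale) auto
  also have "\<dots> \<le> z"
    unfolding mult_Sup by (auto intro: SUP_least)
  finally show "x * y \<le> z" .
qed (auto simp: lhom_def intro: Sup_upper)

definition up_directed :: "'v::order set \<Rightarrow> bool" where
  "up_directed D \<longleftrightarrow> D \<noteq> {} \<and> (\<forall>F. finite F \<and> F \<subseteq> D \<longrightarrow> (\<exists>u\<in>D. \<forall>x\<in>F. x \<le> u))"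


section \<open>Categories, functors and profunctors enriched in a quantale\<close>

text \<open>Underlying sets are explicit carriers, so that they may be empty.\<close>

record ('a, 'v) vcat =
  obj :: "'a set"
  hom :: "'a \<Rightarrow> 'a \<Rightarrow> 'v"

locale vcategory =
  fixes A :: "('a, 'v::quantale, 'm) vcat_scheme"
  assumes hom_refl: "x \<in> obj A \<Longrightarrow> 1 \<le> hom A x x"
    and hom_trans: "x \<in> obj A \<Longrightarrow> y \<in> obj A \<Longrightarrow> z \<in> obj A \<Longrightarrow>
      hom A x y * hom A y z \<le> hom A x z"

definition vfunctor ::
  "('a, 'v::quantale, 'm) vcat_scheme \<Rightarrow> ('c, 'v, 'n) vcat_scheme \<Rightarrow> ('a \<Rightarrow> 'c) \<Rightarrow> bool" where
  "vfunctor A C f \<longleftrightarrow>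
    (\<forall>x\<in>obj A. f x \<in> obj C) \<and>
    (\<forall>x\<in>obj A. \<forall>y\<in>obj A. hom A x y \<le> hom C (f x) (f y))"

definition vprofunctor ::
  "('a, 'v::quantale, 'm) vcat_scheme \<Rightarrow> ('b, 'v, 'n) vcat_scheme \<Rightarrow> ('a \<Rightarrow> 'b \<Rightarrow> 'v) \<Rightarrow> bool" where
  "vprofunctor A B J \<longleftrightarrow>
    (\<forall>x1\<in>obj A. \<forall>x2\<in>obj A. \<forall>y1\<in>obj B. \<forall>y2\<in>obj B.
      hom A x1 x2 * J x2 y1 * hom B y1 y2 \<le> J x1 y2)"


section \<open>Ultrafilters and valued pseudotopological spaces\<close>

definition ultrafilters :: "'a set \<Rightarrow> 'a set set set" where
  "ultrafilters A = {X. X \<subseteq> Pow A \<and> A \<in> X \<and> {} \<notin> X \<and>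
    (\<forall>S\<in>X. \<forall>T\<in>X. S \<inter> T \<in> X) \<and>
    (\<forall>S\<in>X. \<forall>T. S \<subseteq> T \<and> T \<subseteq> A \<longrightarrow> T \<in> X) \<and>
    (\<forall>S\<subseteq>A. S \<in> X \<or> A - S \<in> X)}"

definition principal_uf :: "'a set \<Rightarrow> 'a \<Rightarrow> 'a set set" where
  "principal_uf A x = {S. S \<subseteq> A \<and> x \<in> S}"

definition uf_map :: "'a set \<Rightarrow> 'c set \<Rightarrow> ('a \<Rightarrow> 'c) \<Rightarrow> 'a set set \<Rightarrow> 'c set set" where
  "uf_map A C f X = {T. T \<subseteq> C \<and> {x\<in>A. f x \<in> T} \<in> X}"

definition uf_rel :: "('a \<Rightarrow> 'b \<Rightarrow> 'v::complete_lattice) \<Rightarrow> 'a set set \<Rightarrow> 'b set set \<Rightarrow> 'v" where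
  "uf_rel J X Y = (INF (S, T)\<in>X \<times> Y. SUP (s, t)\<in>S \<times> T. J s t)"

record ('a, 'v) vspace = "('a, 'v) vcat" +
  conv :: "'a set set \<Rightarrow> 'a \<Rightarrow> 'v"

locale modular_pseudotop_space = vcategory A
  for A :: "('a, 'v::quantale, 'm) vspace_scheme" +
  assumes conv_refl: "x \<in> obj A \<Longrightarrow> 1 \<le> conv A (principal_uf (obj A) x) x"
    and conv_modular:
      "X \<in> ultrafilters (obj A) \<Longrightarrow> Y \<in> ultrafilters (obj A) \<Longrightarrow> x \<in> obj A \<Longrightarrow> y \<in> obj A \<Longrightarrow>
        uf_rel (hom A) X Y * conv A Y x * hom A x y \<le> conv A X y"

definition continuous_vmap ::
  "('a, 'v::quantale, 'm) vspace_scheme \<Rightarrow> ('c, 'v, 'n) vspace_scheme \<Rightarrow> ('a \<Rightarrow> 'c) \<Rightarrow> bool" where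
  "continuous_vmap A C f \<longleftrightarrow>
    (\<forall>x\<in>obj A. f x \<in> obj C) \<and>
    (\<forall>X\<in>ultrafilters (obj A). \<forall>x\<in>obj A.
      conv A X x \<le> conv C (uf_map (obj A) (obj C) f X) (f x))"

definition U_compact ::
  "('a, 'v::quantale, 'm) vspace_scheme \<Rightarrow> ('b, 'v, 'n) vcat_scheme \<Rightarrow> ('a \<Rightarrow> 'b \<Rightarrow> 'v) \<Rightarrow> bool" where
  "U_compact A B J \<longleftrightarrow>
    (\<forall>X\<in>ultrafilters (obj A). \<forall>y\<in>obj B.
      (INF S\<in>X. SUP s\<in>S. J s y) \<le> (SUP x\<in>obj A. conv A X x * J x y))"

definition V_lhom :: "('v::quantale, 'v) vspace" where
  "V_lhom = \<lparr>obj = UNIV, hom = (-\<circ>), conv = (\<lambda>X x. (SUP S\<in>X. Inf S) -\<circ> x)\<rparr>"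

lemma V_lhom_simps [simp]:
  "obj V_lhom = UNIV" "hom V_lhom = (-\<circ>)" "conv V_lhom X x = (SUP S\<in>X. Inf S) -\<circ> x"
  by (simp_all add: V_lhom_def)

lemma ultrafilter_INF_Sup_le_SUP_Inf:
  fixes X :: "'v::completely_distributive_quantale set set"
  assumes X: "X \<in> ultrafilters UNIV"
  shows "(INF S\<in>X. Sup S) \<le> (SUP S\<in>X. Inf S)" (is "?v \<le> ?w")
proof -
  obtain L :: "'v \<Rightarrow> 'v set" where L: "\<And>v. downset (L v)"
    "\<And>v D. downset D \<Longrightarrow> L v \<subseteq> D \<longleftrightarrow> v \<le> Sup D"
    using Sup_left_adjoint by metis
  have "a \<le> ?w" if a: "a \<in> L ?v" for a
  proof -
    have meets: "\<exists>t\<in>T. a \<le> t" if T: "T \<in> X" for T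
    proof -
      let ?D = "{x. \<exists>t\<in>T. x \<le> t}"
      have "?v \<le> Sup T" using T by (rule INF_lower)
      also have "\<dots> \<le> Sup ?D" by (rule Sup_subset_mono) auto
      finally have "L ?v \<subseteq> ?D"
        using L(2)[of ?D ?v] by (auto simp: downset_def intro: order_trans)
      then show ?thesis using a by blast
    qed
    have "{t. a \<le> t} \<in> X"
    proof (rule ccontr)
      assume "{t. a \<le> t} \<notin> X"
      then have "UNIV - {t. a \<le> t} \<in> X"
        using X unfolding ultrafilters_def by blast
      from meets[OF this] show False by auto
    qed
    then have "Inf {t. a \<le> t} \<le> ?w" by (rule SUP_upper)
    moreover have "a \<le> Inf {t. a \<le> t}" by (auto intro: Inf_greatest)
    ultimately show ?thesis by (rule order_trans [rotated])
  qed
  then have "Sup (L ?v) \<le> ?w" by (rule Sup_least)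
  moreover have "?v \<le> Sup (L ?v)" using L by blast
  ultimately show ?thesis by (rule order_trans [rotated])
qed

lemma vcategory_V_lhom: "vcategory V_lhom"
proof
  fix x y z :: 'a
  show "1 \<le> hom V_lhom x x" by (simp add: lhom_galois)
  have "x * (x -\<circ> y) * (y -\<circ> z) \<le> y * (y -\<circ> z)"
    by (intro mult_mono_quantale) (simp_all flip: lhom_galois)
  also have "\<dots> \<le> z" by (simp flip: lhom_galois)
  finally show "hom V_lhom x y * hom V_lhom y z \<le> hom V_lhom x z"
    by (simp add: lhom_galois mult.assoc)
qed

lemma modular_pseudotop_space_V_lhom:
  "modular_pseudotop_space (V_lhom :: ('v::completely_distributive_quantale, 'v) vspace)"
proof -
  interpret vcategory V_lhom by (rule vcategory_V_lhom)
  show ?thesis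
  proof
    fix x :: 'v
    have "(SUP S\<in>principal_uf UNIV x. Inf S) \<le> x"
      by (auto simp: principal_uf_def intro: SUP_least Inf_lower)
    then show "1 \<le> conv V_lhom (principal_uf (obj V_lhom) x) x"
      by (simp add: lhom_galois)
  next
    fix X Y :: "'v set set" and x y :: 'v
    assume "X \<in> ultrafilters (obj V_lhom)" "Y \<in> ultrafilters (obj V_lhom)"
    then have Y: "Y \<in> ultrafilters UNIV" by simp
    let ?x = "SUP S\<in>X. Inf S" and ?y = "SUP S\<in>Y. Inf S" and ?u = "uf_rel (-\<circ>) X Y"
    have "Inf S * ?u \<le> Sup T" if "S \<in> X" "T \<in> Y" for S T
    proof -
      have "Inf S * (s -\<circ> t) \<le> Sup T" if "s \<in> S" "t \<in> T" for s t
      proof -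
        have "Inf S * (s -\<circ> t) \<le> s * (s -\<circ> t)"
          using that by (intro mult_mono_quantale Inf_lower) auto
        also have "\<dots> \<le> t" by (simp flip: lhom_galois)
        also have "\<dots> \<le> Sup T" using that by (intro Sup_upper)
        finally show ?thesis .
      qed
      then have "(SUP (s, t)\<in>S \<times> T. s -\<circ> t) \<le> Inf S -\<circ> Sup T"
        by (intro SUP_least) (auto simp: lhom_galois)
      moreover have "?u \<le> (SUP (s, t)\<in>S \<times> T. s -\<circ> t)"
        unfolding uf_rel_def using that by (intro INF_lower2[of "(S, T)"]) auto
      ultimately show ?thesis
        using lhom_galois order_trans by blast
    qed
    then have "?x * ?u \<le> (INF T\<in>Y. Sup T)"
      by (auto simp: Sup_mult image_image intro!: SUP_least INF_greatest)
    also have "\<dots> \<le> ?y" using Y by (rule ultrafilter_INF_Sup_le_SUP_Inf)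
    finally have "?x * ?u * ((?y -\<circ> x) * (x -\<circ> y)) \<le> ?y * ((?y -\<circ> x) * (x -\<circ> y))"
      by (intro mult_mono_quantale) auto
    also have "\<dots> \<le> y"
      using hom_trans[of ?y x y] by (simp add: lhom_galois)
    finally show "uf_rel (hom V_lhom) X Y * conv V_lhom Y x * hom V_lhom x y \<le> conv V_lhom X y"
      by (simp add: lhom_galois mult.assoc)
  qed
qed


section \<open>Left Kan extensions\<close>

text \<open>The universal property quantifies over all \<open>\<V>\<close>-categories \<open>C\<close>; the type argument is
  the type of the objects of \<open>C\<close>. The choice does not matter: see \<open>left_kan_extension_type_indep\<close>.\<close>

definition left_kan_extension ::
  "'c itself \<Rightarrow> ('a, 'v::quantale, 'm) vcat_scheme \<Rightarrow> ('b, 'v, 'n) vcat_scheme \<Rightarrow>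
    ('x, 'v, 'p) vcat_scheme \<Rightarrow> ('a \<Rightarrow> 'x) \<Rightarrow> ('a \<Rightarrow> 'b \<Rightarrow> 'v) \<Rightarrow> ('b \<Rightarrow> 'x) \<Rightarrow> bool" where
  "left_kan_extension _ A B M d J l \<longleftrightarrow>
    vfunctor B M l \<and>
    (\<forall>x\<in>obj A. \<forall>y\<in>obj B. J x y \<le> hom M (d x) (l y)) \<and>
    (\<forall>(C :: ('c, 'v) vcat) H g.
      vcategory C \<and> vprofunctor B C H \<and> vfunctor C M g \<and>
      (\<forall>x\<in>obj A. \<forall>y\<in>obj B. \<forall>z\<in>obj C. J x y * H y z \<le> hom M (d x) (g z)) \<longrightarrow>
      (\<forall>y\<in>obj B. \<forall>z\<in>obj C. H y z \<le> hom M (l y) (g z)))"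

lemma left_kan_extension_type_indep:
  assumes M: "vcategory M"
    and l: "left_kan_extension TYPE('c) A B M d J l"
  shows "left_kan_extension TYPE('e) A B M d J l"
proof -
  have "H y z \<le> hom M (l y) (g z)"
    if C: "vcategory C" and H: "vprofunctor B C H" and g: "vfunctor C M g"
      and le: "\<forall>x\<in>obj A. \<forall>y\<in>obj B. \<forall>z\<in>obj C. J x y * H y z \<le> hom M (d x) (g z)"
      and y: "y \<in> obj B" and z: "z \<in> obj C"
    for C :: "('e, 'b) vcat" and H g y z
  proof -
    let ?C = "\<lparr>obj = {undefined :: 'c}, hom = (\<lambda>_ _. 1 :: 'b)\<rparr>"
    have "vcategory ?C" by unfold_locales auto
    moreover have "vprofunctor B ?C (\<lambda>y _. H y z)"
      unfolding vprofunctor_def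
    proof (intro ballI)
      fix x1 x2 assume x: "x1 \<in> obj B" "x2 \<in> obj B"
      have "hom B x1 x2 * H x2 z * 1 \<le> hom B x1 x2 * H x2 z * hom C z z"
        using vcategory.hom_refl[OF C z] by (intro mult_mono_quantale) auto
      also have "\<dots> \<le> H x1 z"
        using H x z unfolding vprofunctor_def by blast
      finally show "hom B x1 x2 * H x2 z * hom ?C y1 y2 \<le> H x1 z" for y1 y2
        by simp
    qed
    moreover have "vfunctor ?C M (\<lambda>_. g z)"
      using vcategory.hom_refl[OF M] g z by (auto simp: vfunctor_def)
    ultimately show ?thesis
      using l le y z unfolding left_kan_extension_def
      by (auto dest!: spec[of _ ?C] spec[of _ "\<lambda>y _. H y z"] spec[of _ "\<lambda>_. g z"])
  qed
  then show ?thesis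
    using l unfolding left_kan_extension_def by blast
qed

definition beck_chevalley ::
  "('a, 'v::quantale, 'm) vcat_scheme \<Rightarrow> ('b, 'v, 'n) vcat_scheme \<Rightarrow>
    ('x, 'v, 'p) vcat_scheme \<Rightarrow> ('a \<Rightarrow> 'x) \<Rightarrow> ('a \<Rightarrow> 'b \<Rightarrow> 'v) \<Rightarrow> ('b \<Rightarrow> 'x) \<Rightarrow> bool" where
  "beck_chevalley A B M d J l \<longleftrightarrow>
    (\<forall>z\<in>obj M. \<forall>y\<in>obj B. hom M z (l y) = (SUP x\<in>obj A. hom M z (d x) * J x y))"

definition fibre :: "('a, 'v::quantale, 'm) vcat_scheme \<Rightarrow> ('a \<Rightarrow> 'b \<Rightarrow> 'v) \<Rightarrow> 'b \<Rightarrow> 'a set" where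
  "fibre A J y = {x \<in> obj A. 1 \<le> J x y}"

definition discrete_rel ::
  "('a, 'v::quantale, 'm) vcat_scheme \<Rightarrow> ('b, 'v, 'n) vcat_scheme \<Rightarrow> ('a \<Rightarrow> 'b \<Rightarrow> 'v) \<Rightarrow> bool" where
  "discrete_rel A B J \<longleftrightarrow> (\<forall>x\<in>obj A. \<forall>y\<in>obj B. J x y \<in> {bot, 1})"

end

theory Submission
  imports Defs
begin

text \<open>The Beck--Chevalley condition compares two expressions in \<open>z\<close> that are both obtained by
  composing with morphisms out of \<open>z\<close>. As in the Yoneda lemma, it therefore suffices to test it at the
  universal \<open>z = l y\<close> against the identity of \<open>l y\<close>, and only one inequality is at stake there
  (\<open>beck_chevalley_if_unit\<close>): \<open>k \<le> sup\<^sub>x M(l y, d x) \<otimes> J(x, y)\<close>.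

  For \<open>M = \<V>\<^sub>\<multimap>\<close> the extension is the weighted supremum \<open>l y = sup\<^sub>x d x \<otimes> J(x, y)\<close>
  (\<open>left_kan_extension_V_lhom\<close>). When \<open>J\<close> is discrete, tensoring with \<open>J(x, y)\<close> keeps the terms with
  \<open>x\<close> in the fibre \<open>J\<^sub>k\<^sup>\<circ> y\<close> and replaces the others by \<open>\<bottom>\<close> (\<open>SUP_mult_discrete_rel\<close>). So \<open>l y\<close> is
  the supremum of \<open>d (J\<^sub>k\<^sup>\<circ> y)\<close>, and the inequality above becomes precisely condition (d).\<close>

text \<open>The inequality \<open>unit\<close> is the instance \<open>z = l y\<close> of the condition, weakened by
  \<open>1 \<le> hom M (l y) (l y)\<close>. Multiplying it on the left by \<open>hom M z (l y)\<close> and composing in \<open>M\<close> yields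
  the instance at \<open>z\<close>. The other inequality is composition with \<open>J x y \<le> hom M (d x) (l y)\<close>.\<close>

lemma beck_chevalley_if_unit:
  assumes M: "vcategory M"
    and d: "\<And>x. x \<in> obj A \<Longrightarrow> d x \<in> obj M"
    and l: "\<And>y. y \<in> obj B \<Longrightarrow> l y \<in> obj M"
    and cell: "\<And>x y. x \<in> obj A \<Longrightarrow> y \<in> obj B \<Longrightarrow> J x y \<le> hom M (d x) (l y)"
    and unit: "\<And>y. y \<in> obj B \<Longrightarrow> 1 \<le> (SUP x\<in>obj A. hom M (l y) (d x) * J x y)"
  shows "beck_chevalley A B M d J l"
  unfolding beck_chevalley_def
proof (intro ballI antisym)
  fix z y assume z: "z \<in> obj M" and y: "y \<in> obj B"
  have "hom M z (l y) * 1 \<le> hom M z (l y) * (SUP x\<in>obj A. hom M (l y) (d x) * J x y)"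
    using unit[OF y] by (intro mult_mono_quantale) auto
  also have "\<dots> = (SUP x\<in>obj A. hom M z (l y) * hom M (l y) (d x) * J x y)"
    by (simp add: mult_Sup image_image mult.assoc)
  also have "\<dots> \<le> (SUP x\<in>obj A. hom M z (d x) * J x y)"
    using vcategory.hom_trans[OF M z l[OF y] d]
    by (intro SUP_subset_mono mult_mono_quantale) simp_all
  finally show "hom M z (l y) \<le> (SUP x\<in>obj A. hom M z (d x) * J x y)"
    by simp
next
  fix z y assume z: "z \<in> obj M" and y: "y \<in> obj B"
  show "(SUP x\<in>obj A. hom M z (d x) * J x y) \<le> hom M z (l y)"
  proof (rule SUP_least)
    fix x assume x: "x \<in> obj A"
    have "hom M z (d x) * J x y \<le> hom M z (d x) * hom M (d x) (l y)"
      using cell[OF x y] by (intro mult_mono_quantale) auto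
    also have "\<dots> \<le> hom M z (l y)"
      using vcategory.hom_trans[OF M z d[OF x] l[OF y]] .
    finally show "hom M z (d x) * J x y \<le> hom M z (l y)" .
  qed
qed

text \<open>Inserting the identity of \<open>x\<close> on the left turns the two-sided action on a profunctor into the
  action of \<open>B\<close> alone.\<close>

lemma vprofunctor_right:
  assumes A: "vcategory A" and J: "vprofunctor A B J"
    and x: "x \<in> obj A" and y: "y \<in> obj B" "y' \<in> obj B"
  shows "J x y * hom B y y' \<le> J x y'"
proof -
  have "1 * (J x y * hom B y y') \<le> hom A x x * (J x y * hom B y y')"
    using vcategory.hom_refl[OF A x] by (intro mult_mono_quantale) auto
  also have "\<dots> = hom A x x * J x y * hom B y y'"
    by (simp add: mult.assoc)
  also have "\<dots> \<le> J x y'"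
    using J x y unfolding vprofunctor_def by blast
  finally show ?thesis by simp
qed

text \<open>The weighted supremum \<open>L\<close> is itself a functor that admits a cell from \<open>J\<close>, so the universal
  property of \<open>l\<close>, tested with the identity profunctor of \<open>B\<close>, gives \<open>l y \<le> L y\<close>. Conversely, the
  cell of \<open>l\<close> says that \<open>l y\<close> bounds every \<open>d x * J x y\<close>.\<close>

lemma left_kan_extension_V_lhom:
  fixes B :: "('b, 'v::quantale) vcat"
  assumes A: "vcategory A" and B: "vcategory B" and J: "vprofunctor A B J"
    and lan: "left_kan_extension TYPE('c) A B V_lhom d J l"
    and y: "y \<in> obj B"
  shows "l y = (SUP x\<in>obj A. d x * J x y)"
proof (rule antisym)
  define L where "L y = (SUP x\<in>obj A. d x * J x y)" for y
  have lanB: "left_kan_extension TYPE('b) A B V_lhom d J l"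
    using left_kan_extension_type_indep[OF vcategory_V_lhom lan] .
  have step: "d x * (J x y1 * hom B y1 y2) \<le> L y2"
    if "x \<in> obj A" "y1 \<in> obj B" "y2 \<in> obj B" for x y1 y2
  proof -
    have "d x * (J x y1 * hom B y1 y2) \<le> d x * J x y2"
      using vprofunctor_right[OF A J that] by (intro mult_mono_quantale) auto
    also have "\<dots> \<le> L y2"
      unfolding L_def using that by (intro SUP_upper)
    finally show ?thesis .
  qed
  have "vfunctor B V_lhom L"
  proof -
    have "L y1 * hom B y1 y2 \<le> L y2" if "y1 \<in> obj B" "y2 \<in> obj B" for y1 y2
      unfolding L_def[of y1] using step that
      by (auto simp: Sup_mult image_image mult.assoc intro!: SUP_least)
    then show ?thesis
      by (simp add: vfunctor_def lhom_galois)
  qed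
  moreover have "vprofunctor B B (hom B)"
    unfolding vprofunctor_def
  proof (intro ballI)
    fix x1 x2 y1 y2 assume o: "x1 \<in> obj B" "x2 \<in> obj B" "y1 \<in> obj B" "y2 \<in> obj B"
    have "hom B x1 x2 * hom B x2 y1 * hom B y1 y2 \<le> hom B x1 y1 * hom B y1 y2"
      using vcategory.hom_trans[OF B] o by (intro mult_mono_quantale) auto
    also have "\<dots> \<le> hom B x1 y2"
      using vcategory.hom_trans[OF B] o by blast
    finally show "hom B x1 x2 * hom B x2 y1 * hom B y1 y2 \<le> hom B x1 y2" .
  qed
  moreover have "\<forall>x\<in>obj A. \<forall>y\<in>obj B. \<forall>z\<in>obj B. J x y * hom B y z \<le> hom V_lhom (d x) (L z)"
    using step by (simp add: lhom_galois)
  ultimately have "hom B y y \<le> hom V_lhom (l y) (L y)"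
    using lanB B y unfolding left_kan_extension_def by blast
  then have "1 \<le> l y -\<circ> L y"
    using vcategory.hom_refl[OF B y] order_trans by fastforce
  then show "l y \<le> (SUP x\<in>obj A. d x * J x y)"
    by (simp add: lhom_galois L_def)
next
  show "(SUP x\<in>obj A. d x * J x y) \<le> l y"
    using lan y unfolding left_kan_extension_def
    by (auto simp: lhom_galois intro!: SUP_least)
qed

text \<open>Off the fibre \<open>J x y\<close> is \<open>bot\<close>, which is absorbing because it is the empty supremum; on the fibre
  \<open>J x y\<close> is the unit.\<close>

lemma SUP_mult_discrete_rel:
  assumes J: "discrete_rel A B J" and y: "y \<in> obj B"
  shows "(SUP x\<in>obj A. f x * J x y) = (SUP x\<in>fibre A J y. f x)"
proof (rule antisym)
  have bot: "a * bot = bot" for a :: 'b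
    using mult_Sup[of a "{}"] by simp
  show "(SUP x\<in>obj A. f x * J x y) \<le> (SUP x\<in>fibre A J y. f x)"
  proof (rule SUP_least)
    fix x assume x: "x \<in> obj A"
    then consider "J x y = bot" | "J x y = 1"
      using J y unfolding discrete_rel_def by blast
    then show "f x * J x y \<le> (SUP x\<in>fibre A J y. f x)"
    proof cases
      case 1
      then show ?thesis by (simp add: bot)
    next
      case 2
      then have "x \<in> fibre A J y" using x by (simp add: fibre_def)
      then show ?thesis using 2 by (simp add: SUP_upper)
    qed
  qed
  show "(SUP x\<in>fibre A J y. f x) \<le> (SUP x\<in>obj A. f x * J x y)"
  proof (rule SUP_least)
    fix x assume "x \<in> fibre A J y"
    then have x: "x \<in> obj A" and "1 \<le> J x y" by (auto simp: fibre_def)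
    then have "f x * 1 \<le> f x * J x y" by (intro mult_mono_quantale) auto
    also have "\<dots> \<le> (SUP x\<in>obj A. f x * J x y)" using x by (rule SUP_upper)
    finally show "f x \<le> (SUP x\<in>obj A. f x * J x y)" by simp
  qed
qed

theorem theorem8p2:
  fixes A :: "('a, 'v::completely_distributive_quantale) vspace"
    and B :: "('b, 'v) vcat"
    and d :: "'a \<Rightarrow> 'v"
    and J :: "'a \<Rightarrow> 'b \<Rightarrow> 'v"
    and l :: "'b \<Rightarrow> 'v"
  assumes "modular_pseudotop_space A"
    and "vcategory B"
    and "vfunctor A V_lhom d"
    and "continuous_vmap A V_lhom d"
    and "vprofunctor A B J"
    and "left_kan_extension TYPE('c) A B V_lhom d J l"
    and "discrete_rel A B J"
    and "U_compact A B J"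
    and "\<And>y. y \<in> obj B \<Longrightarrow> up_directed (d ` fibre A J y)"
    and "\<And>y. y \<in> obj B \<Longrightarrow> 1 \<le> (SUP z\<in>d ` fibre A J y. Sup (d ` fibre A J y) -\<circ> z)"
  shows "beck_chevalley A B V_lhom d J l"
proof (rule beck_chevalley_if_unit)
  have A: "vcategory A"
    using assms(1) by (rule modular_pseudotop_space.axioms(1))
  show "vcategory (V_lhom :: ('v, 'v) vspace)" by (rule vcategory_V_lhom)
  show "J x y \<le> hom V_lhom (d x) (l y)" if "x \<in> obj A" "y \<in> obj B" for x y
    using assms(6) that unfolding left_kan_extension_def by blast
  show "1 \<le> (SUP x\<in>obj A. hom V_lhom (l y) (d x) * J x y)" if y: "y \<in> obj B" for y
  proof -
    have "l y = Sup (d ` fibre A J y)"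
      using left_kan_extension_V_lhom[OF A assms(2,5,6) y] SUP_mult_discrete_rel[OF assms(7) y]
      by simp
    then show ?thesis
      using assms(10)[OF y] SUP_mult_discrete_rel[OF assms(7) y, of "\<lambda>x. l y -\<circ> d x"]
      by (simp add: image_image)
  qed
qed simp_all

end
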